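(* Let $\mathcal{D}$ be a dyadic lattice in $\mathbb{R}^d$ and let $\mathcal{S}\subset\mathcal{D}$ be a Carleson collection of cubes such that $\pi Q\in\mathcal{S}$ for each cube $Q\in\mathcal{S}$. Then there is a porous set $E\subset\mathbb{R}^d$ with $\mathcal{S}\subset\mathcal{D}_E$.
   Context: $|A|$ denotes $d$-dimensional Lebesgue measure of $A$. A cube is a half-open set $Q=[a_1,b_1)\times\dots\times[a_d,b_d)$ with equal side lengths $\ell(Q)=b_1-a_1=\dots=b_d-a_d>0$. For a cube $R$, $\mathcal{D}(R)=\bigcup_{j\ge0}\mathcal{D}_j(R)$, where $\mathcal{D}_j(R)$ is the collection of the $2^{jd}$ pairwise disjoint half-open cubes of side length $2^{-j}\ell(R)$ whose union is $R$. A dyadic lattice $\mathcal{D}$ is a collection of cubes such that: (DL1) if $Q\in\mathcal{D}$ then $\mathcal{D}(Q)\subset\mathcal{D}$; (DL2) any two cubes $Q',Q''\in\mathcal{D}$ have a common ancestor, i.e. there is $Q\in\mathcal{D}$ with $Q',Q''\in\mathcal{D}(Q)$; (DL3) for every compact $K\subset\mathbb{R}^d$ there is a cube $Q\in\mathcal{D}$ containing $K$. For $Q\in\mathcal{D}$, $\pi Q$ is the unique cube in $\mathcal{D}$ with $Q\in\mathcal{D}_1(\pi Q)$. A collection $\mathcal{S}\subset\mathcal{D}$ is Carleson if there is a constant $\xi>0$ such that $\sum_{Q\in\mathcal{S},\,Q\subset R}|Q|\le\xi|R|$ for each cube $R\in\mathcal{D}$. $\mathcal{D}_E=\{Q\in\mathcal{D}: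 Q\cap E\ne\varnothing\}$. A cube $Q'\in\mathcal{D}$ is called free if $Q'\cap E=\varnothing$. A nonempty set $E\subset\mathbb{R}^d$ is porous (with respect to $\mathcal{D}$) if there is a constant $\eta>1$ such that for each $R\in\mathcal{D}$ there is a free cube $M(R)\in\mathcal{D}$, $M(R)\subset R$, with $\eta|M(R)|\ge|R|$. *)

theory Defs
  imports "HOL-Analysis.Analysis"
begin

definition hcube :: "real ^ 'd \<Rightarrow> real \<Rightarrow> (real ^ 'd) set" where
  "hcube a l = {x. \<forall>i. a $ i \<le> x $ i \<and> x $ i < a $ i + l}"

definition is_cube :: "(real ^ 'd) set \<Rightarrow> bool" where
  "is_cube Q \<longleftrightarrow> (\<exists>a l. l > 0 \<and> Q = hcube a l)"

text \<open>The grid subdivision of a cube is written out explicitly. The corner \<open>a\<close> and the side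
  length \<open>l > 0\<close> are determined by \<open>R\<close> (lemma \<open>hcube_eq_iff\<close>); the lemmas \<open>gen_hcube\<close>,
  \<open>Union_gen\<close>, \<open>disjoint_gen\<close> and \<open>card_gen\<close> show that \<open>gen j R\<close> consists of
  \<open>2 ^ (j * CARD('d))\<close> pairwise disjoint cubes of side length \<open>l / 2 ^ j\<close> with union \<open>R\<close>.\<close>

definition gen :: "nat \<Rightarrow> (real ^ 'd) set \<Rightarrow> (real ^ 'd) set set" where
  "gen j R = {hcube (\<chi> i. a $ i + real (k i) * (l / 2 ^ j)) (l / 2 ^ j) | a l k.
                l > 0 \<and> R = hcube a l \<and> (\<forall>i. k i < 2 ^ j)}"

definition descendants :: "(real ^ 'd) set \<Rightarrow> (real ^ 'd) set set" where
  "descendants R = (\<Union>j. gen j R)"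

definition dyadic_lattice :: "(real ^ 'd) set set \<Rightarrow> bool" where
  "dyadic_lattice \<D> \<longleftrightarrow>
     (\<forall>Q\<in>\<D>. is_cube Q) \<and>
     (\<forall>Q\<in>\<D>. descendants Q \<subseteq> \<D>) \<and>
     (\<forall>Q'\<in>\<D>. \<forall>Q''\<in>\<D>. \<exists>Q\<in>\<D>. Q' \<in> descendants Q \<and> Q'' \<in> descendants Q) \<and>
     (\<forall>K. compact K \<longrightarrow> (\<exists>Q\<in>\<D>. K \<subseteq> Q))"

text \<open>For \<open>Q\<close> in a dyadic lattice the description below is proper, see \<open>ex1_parent\<close>.\<close>

definition parent :: "(real ^ 'd) set set \<Rightarrow> (real ^ 'd) set \<Rightarrow> (real ^ 'd) set" where
  "parent \<D> Q = (THE P. P \<in> \<D> \<and> Q \<in> gen 1 P)"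

text \<open>The possibly infinite sum is taken in the extended nonnegative reals, where it always
  converges; finiteness is part of the inequality.\<close>

definition Carleson :: "(real ^ 'd) set set \<Rightarrow> (real ^ 'd) set set \<Rightarrow> bool" where
  "Carleson \<D> \<S> \<longleftrightarrow>
     \<S> \<subseteq> \<D> \<and>
     (\<exists>\<xi>::real. \<xi> > 0 \<and>
        (\<forall>R\<in>\<D>. (\<Sum>\<^sub>\<infinity>Q\<in>{Q \<in> \<S>. Q \<subseteq> R}. emeasure lebesgue Q) \<le> ennreal \<xi> * emeasure lebesgue R))"

definition cubes_meeting :: "(real ^ 'd) set set \<Rightarrow> (real ^ 'd) set \<Rightarrow> (real ^ 'd) set set" where
  "cubes_meeting \<D> E = {Q \<in> \<D>. Q \<inter> E \<noteq> {}}"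

definition free_cube :: "(real ^ 'd) set set \<Rightarrow> (real ^ 'd) set \<Rightarrow> (real ^ 'd) set \<Rightarrow> bool" where
  "free_cube \<D> E Q \<longleftrightarrow> Q \<in> \<D> \<and> Q \<inter> E = {}"

definition porous :: "(real ^ 'd) set set \<Rightarrow> (real ^ 'd) set \<Rightarrow> bool" where
  "porous \<D> E \<longleftrightarrow>
     E \<noteq> {} \<and>
     (\<exists>\<eta>::real. \<eta> > 1 \<and>
        (\<forall>R\<in>\<D>. \<exists>M. free_cube \<D> E M \<and> M \<subseteq> R \<and> \<eta> * measure lebesgue M \<ge> measure lebesgue R))"

lemma corner_in_hcube: "l > 0 \<Longrightarrow> a \<in> hcube a l"
  by (simp add: hcube_def)

lemma hcube_subset_bounds:
  assumes "l > 0" "hcube a l \<subseteq> hcube b m"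
  shows "b $ i \<le> a $ i" "a $ i + l \<le> b $ i + m"
proof -
  have a: "a \<in> hcube b m"
    using corner_in_hcube[OF assms(1), of a] assms(2) by blast
  then show "b $ i \<le> a $ i"
    by (auto simp: hcube_def)
  show "a $ i + l \<le> b $ i + m"
  proof (rule ccontr)
    assume n: "\<not> a $ i + l \<le> b $ i + m"
    let ?x = "\<chi> j. if j = i then b $ i + m else a $ j"
    have "a $ i < b $ i + m" using a by (auto simp: hcube_def)
    then have "?x \<in> hcube a l"
      using n assms(1) by (auto simp: hcube_def)
    then have "?x \<in> hcube b m"
      using assms(2) by blast
    then show False
      by (auto simp: hcube_def dest: spec[of _ i])
  qed
qed

lemma hcube_eq_iff:
  assumes "l > 0" "m > 0"
  shows "hcube a l = hcube b m \<longleftrightarrow> a = b \<and> l = m"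
proof
  assume e: "hcube a l = hcube b m"
  have "b $ i = a $ i" "a $ i + l = b $ i + m" for i
    using hcube_subset_bounds[of l a b m i] hcube_subset_bounds[of m b a l i] assms e by force+
  then show "a = b \<and> l = m"
    by (auto simp: vec_eq_iff)
qed auto

lemma gen_hcube:
  assumes "l > 0"
  shows "gen j (hcube a l) =
    (\<lambda>k. hcube (\<chi> i. a $ i + real (k i) * (l / 2 ^ j)) (l / 2 ^ j)) ` {k. \<forall>i. k i < 2 ^ j}"
  unfolding gen_def using assms by (auto simp: hcube_eq_iff)

lemma grid_index_unique:
  fixes x h :: real
  assumes "h > 0" "a + real m * h \<le> x" "x < a + real m * h + h"
    "a + real n * h \<le> x" "x < a + real n * h + h"
  shows "m = n"
proof -
  have "real m * h < (real n + 1) * h" "real n * h < (real m + 1) * h"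
    using assms by (simp_all add: algebra_simps)
  then have "real m < real n + 1" "real n < real m + 1"
    using assms(1) by (simp_all only: mult_less_cancel_right_pos)
  then show ?thesis by linarith
qed

lemma Union_gen:
  assumes "is_cube R"
  shows "\<Union> (gen j R) = R"
proof -
  obtain a l where l: "l > 0" and R: "R = hcube a l"
    using assms by (auto simp: is_cube_def)
  define h where "h = l / 2 ^ j"
  have h: "h > 0" "l = 2 ^ j * h" using l by (auto simp: h_def)
  have "hcube (\<chi> i. a $ i + real (k i) * h) h \<subseteq> R" if k: "\<forall>i. k i < 2 ^ j" for k :: "'a \<Rightarrow> nat"
  proof
    fix x assume x: "x \<in> hcube (\<chi> i. a $ i + real (k i) * h) h"
    have "a $ i \<le> x $ i \<and> x $ i < a $ i + l" for i
    proof -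
      have b: "a $ i + real (k i) * h \<le> x $ i" "x $ i < a $ i + real (k i) * h + h"
        using x by (auto simp: hcube_def)
      have "real (k i + 1) \<le> real (2 ^ j)"
        using k by (metis Suc_eq_plus1 Suc_leI of_nat_le_iff)
      then have "real (k i + 1) * h \<le> 2 ^ j * h"
        using h by (intro mult_right_mono) auto
      moreover have "0 \<le> real (k i) * h" using h by simp
      moreover have "real (k i + 1) * h = real (k i) * h + h" by (simp add: algebra_simps)
      ultimately show ?thesis using b h(2) by linarith
    qed
    then show "x \<in> R" by (auto simp: R hcube_def)
  qed
  moreover have "\<exists>k. (\<forall>i. k i < 2 ^ j) \<and> x \<in> hcube (\<chi> i. a $ i + real (k i) * h) h"
    if x: "x \<in> R" for x
  proof -
    define k where "k i = nat \<lfloor>(x $ i - a $ i) / h\<rfloor>" for i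
    have b: "a $ i \<le> x $ i" "x $ i < a $ i + l" for i
      using x by (auto simp: R hcube_def)
    have f: "real (k i) = of_int \<lfloor>(x $ i - a $ i) / h\<rfloor>" for i
      unfolding k_def using b[of i] h by simp
    have lo: "real (k i) \<le> (x $ i - a $ i) / h" and hi: "(x $ i - a $ i) / h < real (k i) + 1" for i
      unfolding f by linarith+
    have "(x $ i - a $ i) / h < 2 ^ j" for i
      using b[of i] h by (simp add: pos_divide_less_eq algebra_simps)
    then have "real (k i) < real (2 ^ j)" for i
      using lo[of i] by (metis le_less_trans of_nat_numeral of_nat_power)
    then have "k i < 2 ^ j" for i
      using of_nat_less_iff by blast
    moreover have "x \<in> hcube (\<chi> i. a $ i + real (k i) * h) h"
      using lo hi h by (auto simp: hcube_def pos_divide_less_eq pos_le_divide_eq algebra_simps)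
    ultimately show ?thesis by blast
  qed
  ultimately show ?thesis
    unfolding gen_hcube[OF l, of j a, folded R h_def] by blast
qed

lemma disjoint_gen:
  assumes "is_cube R"
  shows "disjoint (gen j R)"
proof -
  obtain a l where l: "l > 0" and R: "R = hcube a l"
    using assms by (auto simp: is_cube_def)
  define h where "h = l / 2 ^ j"
  have h: "h > 0" using l by (auto simp: h_def)
  have "k = k'" if "x \<in> hcube (\<chi> i. a $ i + real (k i) * h) h"
    "x \<in> hcube (\<chi> i. a $ i + real (k' i) * h) h" for x and k k' :: "'a \<Rightarrow> nat"
  proof
    fix i
    show "k i = k' i"
      by (rule grid_index_unique[OF h, of "a $ i" _ "x $ i"]) (use that in \<open>auto simp: hcube_def\<close>)
  qed
  then show ?thesis
    unfolding R gen_hcube[OF l] h_def[symmetric] disjoint_def by blast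
qed

lemma card_gen:
  fixes R :: "(real ^ 'd) set"
  assumes "is_cube R"
  shows "card (gen j R) = 2 ^ (j * CARD('d))"
proof -
  obtain a l where l: "l > 0" and R: "R = hcube a l"
    using assms by (auto simp: is_cube_def)
  have "inj_on (\<lambda>k. hcube (\<chi> i. a $ i + real (k i) * (l / 2 ^ j)) (l / 2 ^ j)) {k. \<forall>i. k i < 2 ^ j}"
    using l by (auto simp: inj_on_def hcube_eq_iff vec_eq_iff fun_eq_iff)
  moreover have "{k :: 'd \<Rightarrow> nat. \<forall>i. k i < 2 ^ j} = PiE UNIV (\<lambda>_. {..<2 ^ j})"
    by (auto simp: PiE_def Pi_def)
  ultimately show ?thesis
    unfolding R gen_hcube[OF l] by (simp add: card_image card_PiE power_mult)
qed

lemma is_cube_gen: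
  assumes "Q \<in> gen j R"
  shows "is_cube Q" "is_cube R"
proof -
  obtain a l k where *: "Q = hcube (\<chi> i. a $ i + real (k i) * (l / 2 ^ j)) (l / 2 ^ j)" "l > 0"
    "R = hcube a l"
    using assms by (auto simp: gen_def)
  moreover have "l / 2 ^ j > 0" using * by simp
  ultimately show "is_cube Q" "is_cube R" unfolding is_cube_def by blast+
qed

lemma ex1_parent:
  fixes Q :: "(real ^ 'd) set"
  assumes D: "dyadic_lattice \<D>" and Q: "Q \<in> \<D>"
  shows "\<exists>!P. P \<in> \<D> \<and> Q \<in> gen 1 P"
proof -
  have cube: "is_cube P" if "P \<in> \<D>" for P
    using D that by (auto simp: dyadic_lattice_def)
  have DL1: "descendants P \<subseteq> \<D>" if "P \<in> \<D>" for P
    using D that by (auto simp: dyadic_lattice_def)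
  have DL2: "\<exists>A\<in>\<D>. P \<in> descendants A \<and> P' \<in> descendants A" if "P \<in> \<D>" "P' \<in> \<D>" for P P'
    using D that by (auto simp: dyadic_lattice_def)
  have DL3: "\<exists>R\<in>\<D>. K \<subseteq> R" if "compact K" for K
    using D that by (auto simp: dyadic_lattice_def)
  obtain a l where l: "l > 0" and Qa: "Q = hcube a l"
    using cube[OF Q] by (auto simp: is_cube_def)
  have side: "\<exists>c. P = hcube c (2 * l)" if "Q \<in> gen 1 P" for P
    using that l unfolding gen_def Qa by (auto simp: hcube_eq_iff)
  show ?thesis
  proof (rule ex_ex1I)
    obtain R where R: "R \<in> \<D>" "cball a (l * real CARD('d)) \<subseteq> R"
      using DL3[OF compact_cball] by blast
    obtain A where A: "A \<in> \<D>" "Q \<in> descendants A" "R \<in> descendants A"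
      using DL2[OF Q R(1)] by blast
    obtain b m where m: "m > 0" and Ab: "A = hcube b m"
      using cube[OF A(1)] by (auto simp: is_cube_def)
    obtain j where j: "Q \<in> gen j A"
      using A(2) by (auto simp: descendants_def)
    have "R \<subseteq> A"
      using A(3) Union_gen[OF cube[OF A(1)]] by (auto simp: descendants_def)
    define p :: "real ^ 'd" where "p = a + (\<chi> i. l)"
    have "norm (\<chi> i::'d. l) \<le> (\<Sum>i\<in>UNIV. \<bar>(\<chi> i::'d. l) $ i\<bar>)"
      by (rule norm_le_l1_cart)
    then have "norm (\<chi> i::'d. l) \<le> l * real CARD('d)"
      using l by (simp add: algebra_simps)
    then have "p \<in> cball a (l * real CARD('d))"
      by (simp add: p_def dist_norm)
    then have "p \<in> A"
      using R(2) \<open>R \<subseteq> A\<close> by blast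
    moreover have "gen 0 A = {A}"
    proof -
      have "{k :: 'd \<Rightarrow> nat. \<forall>i. k i < 2 ^ 0} = {\<lambda>_. 0}" by auto
      then show ?thesis unfolding Ab gen_hcube[OF m] by simp
    qed
    moreover have "p \<notin> Q" by (auto simp: p_def Qa hcube_def)
    ultimately have "j \<noteq> 0"
      using j by (cases j) auto
    then obtain n where n: "j = Suc n" using not0_implies_Suc by blast
    obtain k where k: "\<forall>i. k i < 2 ^ j"
      and Qk: "Q = hcube (\<chi> i. b $ i + real (k i) * (m / 2 ^ j)) (m / 2 ^ j)"
      using j unfolding Ab gen_hcube[OF m] by auto
    define P where "P = hcube (\<chi> i. b $ i + real (k i div 2) * (m / 2 ^ n)) (m / 2 ^ n)"
    have "k i div 2 < 2 ^ n" for i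
      using k[rule_format, of i] by (simp add: n)
    then have "P \<in> gen n A"
      unfolding Ab gen_hcube[OF m] P_def by (intro image_eqI[where x = "\<lambda>i. k i div 2"]) auto
    then have "P \<in> \<D>"
      using DL1[OF A(1)] by (auto simp: descendants_def)
    moreover have "Q \<in> gen 1 P"
    proof -
      have e: "real (k i) = 2 * real (k i div 2) + real (k i mod 2)" for i
        by (metis mult_div_mod_eq of_nat_add of_nat_mult of_nat_numeral)
      have "b $ i + real (k i) * (m / 2 ^ j) =
          b $ i + real (k i div 2) * (m / 2 ^ n) + real (k i mod 2) * (m / 2 ^ n / 2 ^ 1)" for i
        unfolding e[of i] by (simp add: n field_simps)
      then have "Q = hcube (\<chi> i. (\<chi> i. b $ i + real (k i div 2) * (m / 2 ^ n)) $ i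
          + real (k i mod 2) * (m / 2 ^ n / 2 ^ 1)) (m / 2 ^ n / 2 ^ 1)"
        unfolding Qk by (simp only: vec_lambda_beta) (simp add: n mult.commute)
      then show ?thesis
        unfolding P_def using m
        by (subst gen_hcube) (auto intro!: image_eqI[where x = "\<lambda>i. k i mod 2"])
    qed
    ultimately show "\<exists>P. P \<in> \<D> \<and> Q \<in> gen 1 P" by blast
  next
    fix P P' assume P: "P \<in> \<D> \<and> Q \<in> gen 1 P" and P': "P' \<in> \<D> \<and> Q \<in> gen 1 P'"
    obtain A i j where A: "A \<in> \<D>" "P \<in> gen i A" "P' \<in> gen j A"
      using DL2[of P P'] P P' unfolding descendants_def by blast
    obtain b m where m: "m > 0" and Ab: "A = hcube b m"
      using cube[OF A(1)] by (auto simp: is_cube_def)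
    have gs: "2 * l = m / 2 ^ r" if "hcube c (2 * l) \<in> gen r A" for c :: "real ^ 'd" and r
      using that l m unfolding Ab gen_hcube[OF m] by (auto simp: hcube_eq_iff)
    obtain c c' where cc: "P = hcube c (2 * l)" "P' = hcube c' (2 * l)"
      using side P P' by blast
    then have "m / 2 ^ i = m / 2 ^ j"
      using A gs by metis
    then have "i = j" using m by (simp add: field_simps)
    moreover have "a \<in> Q" using l by (simp add: Qa corner_in_hcube)
    then have "a \<in> P" "a \<in> P'"
      using P P' Union_gen[OF cube] by blast+
    ultimately show "P = P'"
      using A disjoint_gen[OF cube[OF A(1)], of j] unfolding disjoint_def by blast
  qed
qed

end

(* E consists of one point in each maximal cube of D - S (a cube outside S whose parent is in S).
   By the parent condition S is closed under ancestors, so a cube R outside S meets E in at most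
   one point, and hence has a free child. By the Carleson condition, a cube R in S cannot have all
   its descendants of generations 0, ..., N in S once N + 1 exceeds the Carleson constant; therefore
   it has a descendant outside S of comparable size, which gives porosity, and it contains a
   maximal cube of D - S, so it meets E. *)

theory Submission
  imports Defs
begin

section \<open>Generations of subcubes\<close>

lemma gen_0:
  assumes "is_cube R"
  shows "gen 0 R = {R}"
proof -
  obtain a l where l: "l > 0" and R: "R = hcube a l"
    using assms by (auto simp: is_cube_def)
  have "{k :: 'a \<Rightarrow> nat. \<forall>i. k i < 2 ^ 0} = {\<lambda>_. 0}" by auto
  then show ?thesis unfolding R gen_hcube[OF l] by simp
qed

lemma gen_subset: "Q \<in> gen j R \<Longrightarrow> Q \<subseteq> R"
  using Union_gen is_cube_gen(2) by blast

lemma cube_nonempty: "is_cube Q \<Longrightarrow> Q \<noteq> {}"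
  using corner_in_hcube by (auto simp: is_cube_def)

text \<open>An infinite set has \<open>card\<close> 0 by convention, and a power of two is never
  0.\<close>

lemma finite_gen: "is_cube R \<Longrightarrow> finite (gen j R)"
  using card_gen[of R j] by (metis card.infinite power_not_zero zero_neq_numeral)

text \<open>Grid indices concatenate like binary digits: the coarse index \<open>k\<close> and the
  fine index \<open>k'\<close> combine to \<open>k * 2 ^ j + k'\<close>.\<close>

lemma gen_trans:
  assumes "P \<in> gen i R" "Q \<in> gen j P"
  shows "Q \<in> gen (i + j) R"
proof -
  obtain a l where l: "l > 0" and R: "R = hcube a l"
    using is_cube_gen(2)[OF assms(1)] by (auto simp: is_cube_def)
  obtain k where k: "\<And>x. k x < 2 ^ i"
    and P: "P = hcube (\<chi> x. a $ x + real (k x) * (l / 2 ^ i)) (l / 2 ^ i)"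
    using assms(1) unfolding R gen_hcube[OF l] by auto
  have l': "l / 2 ^ i > 0" using l by simp
  obtain k' where k': "\<And>x. k' x < 2 ^ j"
    and Q: "Q = hcube (\<chi> x. a $ x + real (k x) * (l / 2 ^ i) + real (k' x) * (l / 2 ^ i / 2 ^ j))
              (l / 2 ^ i / 2 ^ j)"
    using assms(2) unfolding P gen_hcube[OF l'] by auto
  define m where "m x = k x * 2 ^ j + k' x" for x
  have "m x < 2 ^ (i + j)" for x
  proof -
    have "m x < (k x + 1) * 2 ^ j" using k'[of x] by (simp add: m_def)
    also have "\<dots> \<le> 2 ^ i * 2 ^ j" using k[of x] by (intro mult_right_mono) auto
    finally show ?thesis by (simp add: power_add)
  qed
  moreover have "Q = hcube (\<chi> x. a $ x + real (m x) * (l / 2 ^ (i + j))) (l / 2 ^ (i + j))"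
    unfolding Q m_def by (simp add: power_add field_simps)
  ultimately show ?thesis
    unfolding R gen_hcube[OF l] by blast
qed

text \<open>Converse of \<open>gen_trans\<close>: dividing the grid index by \<open>2 ^ j\<close>,
  the quotient locates the intermediate ancestor and the remainder the position of \<open>Q\<close>
  inside it.\<close>

lemma gen_split:
  assumes "Q \<in> gen (i + j) R"
  obtains P where "P \<in> gen i R" "Q \<in> gen j P"
proof -
  obtain a l where l: "l > 0" and R: "R = hcube a l"
    using is_cube_gen(2)[OF assms(1)] by (auto simp: is_cube_def)
  have l': "l / 2 ^ i > 0" using l by simp
  obtain m where m: "\<And>x. m x < 2 ^ (i + j)"
    and Q: "Q = hcube (\<chi> x. a $ x + real (m x) * (l / 2 ^ (i + j))) (l / 2 ^ (i + j))"
    using assms unfolding R gen_hcube[OF l] by auto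
  define k where "k x = m x div 2 ^ j" for x
  define k' where "k' x = m x mod 2 ^ j" for x
  define P where "P = hcube (\<chi> x. a $ x + real (k x) * (l / 2 ^ i)) (l / 2 ^ i)"
  have "k x < 2 ^ i" for x
    using m[of x] unfolding k_def by (simp add: less_mult_imp_div_less power_add)
  then have "P \<in> gen i R"
    unfolding R gen_hcube[OF l] P_def by blast
  moreover have "Q \<in> gen j P"
  proof -
    have "m x = k x * 2 ^ j + k' x" for x
      unfolding k_def k'_def by (rule div_mult_mod_eq[symmetric])
    then have "real (m x) = real (k x) * 2 ^ j + real (k' x)" for x
      by simp
    then have "Q = hcube (\<chi> x. a $ x + real (k x) * (l / 2 ^ i) + real (k' x) * (l / 2 ^ i / 2 ^ j))
              (l / 2 ^ i / 2 ^ j)"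
      unfolding Q by (simp add: power_add field_simps)
    moreover have "\<And>x. k' x < 2 ^ j" by (simp add: k'_def)
    ultimately show ?thesis
      unfolding P_def gen_hcube[OF l'] by auto
  qed
  ultimately show thesis by (rule that)
qed

text \<open>The side length reveals the generation. This permits summing over several generations
  without counting a cube twice.\<close>

lemma gen_disjoint_levels:
  assumes "i \<noteq> j"
  shows "gen i R \<inter> gen j R = {}"
proof (rule ccontr)
  assume "gen i R \<inter> gen j R \<noteq> {}"
  then obtain Q where Q: "Q \<in> gen i R" "Q \<in> gen j R" by blast
  obtain a l where l: "l > 0" and R: "R = hcube a l"
    using is_cube_gen(2)[OF Q(1)] by (auto simp: is_cube_def)
  have "l / 2 ^ i = l / 2 ^ j"
    using Q l unfolding R gen_hcube[OF l] by (auto simp: hcube_eq_iff)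
  then show False using l assms by (simp add: field_simps)
qed

section \<open>Lebesgue measure of cubes\<close>

lemma emeasure_hcube:
  fixes a :: "real ^ 'd"
  assumes "l > 0"
  shows "emeasure lebesgue (hcube a l) = ennreal (l ^ CARD('d))"
proof -
  define b where "b = a + (\<chi> i. l)"
  \<comment> \<open>The half-open cube is squeezed between an open and a closed box of equal
    volume.\<close>
  have sub: "box a b \<subseteq> hcube a l" "hcube a l \<subseteq> cbox a b"
    by (auto simp: hcube_def b_def mem_box_cart less_imp_le)
  have meas: "hcube a l \<in> sets borel"
    unfolding hcube_def by measurable
  have le: "a \<bullet> c \<le> b \<bullet> c" if "c \<in> Basis" for c
    using that assms by (auto simp: b_def Basis_vec_def inner_axis)
  have "(\<Prod>c\<in>Basis. (b - a) \<bullet> c) = (\<Prod>c\<in>(Basis :: (real ^ 'd) set). l)"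
    by (rule prod.cong) (auto simp: b_def Basis_vec_def inner_axis)
  then have eq: "(\<Prod>c\<in>Basis. (b - a) \<bullet> c) = l ^ CARD('d)"
    by simp
  have "emeasure lborel (hcube a l) = ennreal (l ^ CARD('d))"
  proof (rule antisym)
    show "emeasure lborel (hcube a l) \<le> ennreal (l ^ CARD('d))"
      using emeasure_mono[OF sub(2), of lborel] le by (simp add: eq)
    show "ennreal (l ^ CARD('d)) \<le> emeasure lborel (hcube a l)"
      using emeasure_mono[OF sub(1), of lborel] meas le by (simp add: eq)
  qed
  then show ?thesis
    using meas by (simp add: emeasure_completion)
qed

lemma cube_measure:
  assumes "is_cube R"
  shows "emeasure lebesgue R = ennreal (measure lebesgue R)" "measure lebesgue R > 0"
proof -
  obtain a l where l: "l > 0" and R: "R = hcube a l"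
    using assms by (auto simp: is_cube_def)
  show "emeasure lebesgue R = ennreal (measure lebesgue R)" "measure lebesgue R > 0"
    using l by (simp_all add: R emeasure_hcube measure_def)
qed

lemma measure_gen:
  fixes R :: "(real ^ 'd) set"
  assumes "Q \<in> gen j R"
  shows "measure lebesgue R = 2 ^ (j * CARD('d)) * measure lebesgue Q"
proof -
  obtain a l where l: "l > 0" and R: "R = hcube a l"
    using is_cube_gen(2)[OF assms(1)] by (auto simp: is_cube_def)
  obtain b where Q: "Q = hcube b (l / 2 ^ j)"
    using assms unfolding R gen_hcube[OF l] by auto
  show ?thesis
    using l by (simp add: R Q emeasure_hcube measure_def power_divide power_mult)
qed

section \<open>Nesting and ancestors in a dyadic lattice\<close>

lemma
  assumes "dyadic_lattice \<D>"
  shows lattice_cube: "Q \<in> \<D> \<Longrightarrow> is_cube Q"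
    and lattice_gen: "R \<in> \<D> \<Longrightarrow> Q \<in> gen j R \<Longrightarrow> Q \<in> \<D>"
  using assms unfolding dyadic_lattice_def descendants_def by blast+

lemma parent_eq:
  assumes "dyadic_lattice \<D>" "P \<in> \<D>" "Q \<in> gen 1 P"
  shows "parent \<D> Q = P"
  unfolding parent_def
  by (rule the1_equality) (use assms lattice_gen ex1_parent in blast)+

text \<open>Inside a common ancestor \<open>A\<close>, the cube of later generation has an ancestor
  in the generation of the other; these two intersect, so by disjointness of a generation they
  coincide.\<close>

lemma lattice_nested:
  assumes D: "dyadic_lattice \<D>" and QR: "Q \<in> \<D>" "R \<in> \<D>" "Q \<inter> R \<noteq> {}"
  shows "Q \<in> descendants R \<or> R \<in> descendants Q"
proof -
  obtain A i j where A: "A \<in> \<D>" "Q \<in> gen i A" "R \<in> gen j A"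
    using D QR by (auto simp: dyadic_lattice_def descendants_def) metis
  have nested: "Y \<in> descendants X"
    if "X \<in> gen m A" "Y \<in> gen n A" "X \<inter> Y \<noteq> {}" "m \<le> n" for X Y m n
  proof -
    have "Y \<in> gen (m + (n - m)) A" using that by simp
    then obtain Z where Z: "Z \<in> gen m A" "Y \<in> gen (n - m) Z" by (rule gen_split)
    have "Z \<inter> X \<noteq> {}" using gen_subset[OF Z(2)] that(3) by blast
    then have "Z = X"
      using disjoint_gen[OF lattice_cube[OF D A(1)], of m] Z(1) that(1)
      unfolding disjoint_def by blast
    then show ?thesis using Z(2) by (auto simp: descendants_def)
  qed
  show ?thesis
    using nested[OF A(2,3)] nested[OF A(3,2)] QR(3) linear[of i j] by (auto simp: Int_commute)
qed

text \<open>The parent condition is climbed one generation at a time. In contrapositive form: a cube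
  outside \<open>\<S>\<close> has no descendant in \<open>\<S>\<close>.\<close>

lemma ancestor_closed:
  assumes D: "dyadic_lattice \<D>" and S: "\<forall>Q\<in>\<S>. parent \<D> Q \<in> \<S>" and R: "R \<in> \<D>"
  shows "Q \<in> gen j R \<Longrightarrow> Q \<in> \<S> \<Longrightarrow> R \<in> \<S>"
proof (induction j arbitrary: Q)
  case 0
  then show ?case using gen_0[OF lattice_cube[OF D R]] by simp
next
  case (Suc j)
  have "Q \<in> gen (j + 1) R" using Suc.prems(1) by simp
  then obtain P where P: "P \<in> gen j R" "Q \<in> gen 1 P" by (rule gen_split)
  then have "parent \<D> Q = P" using parent_eq[OF D lattice_gen[OF D R]] by blast
  then show ?case using Suc.IH[OF P(1)] S Suc.prems(2) by auto
qed

section \<open>The Carleson condition\<close>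

text \<open>Every full generation of \<open>R\<close> has total measure |R|, so too many of them
  inside \<open>\<S>\<close> would violate the Carleson bound. The point is that \<open>N\<close>
  depends on \<xi> alone and serves all \<open>R\<close> at once.\<close>

lemma Carleson_gap:
  assumes D: "dyadic_lattice \<D>" and "Carleson \<D> \<S>"
  obtains N where "\<And>R. R \<in> \<D> \<Longrightarrow> \<exists>j\<le>N. \<exists>Q\<in>gen j R. Q \<notin> \<S>"
proof -
  obtain \<xi> :: real where xi: "\<xi> > 0"
    "\<And>R. R \<in> \<D> \<Longrightarrow>
      (\<Sum>\<^sub>\<infinity>Q\<in>{Q \<in> \<S>. Q \<subseteq> R}. emeasure lebesgue Q) \<le> ennreal \<xi> * emeasure lebesgue R"
    using assms(2) unfolding Carleson_def by blast
  obtain N where N: "\<xi> < real N" using reals_Archimedean2 by blast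
  show thesis
  proof (rule that[of N], rule ccontr)
    fix R assume R: "R \<in> \<D>" and "\<not> (\<exists>j\<le>N. \<exists>Q\<in>gen j R. Q \<notin> \<S>)"
    then have all: "gen j R \<subseteq> \<S>" if "j \<le> N" for j using that by blast
    have cR: "is_cube R" by (rule lattice_cube[OF D R])
    have level: "(\<Sum>Q\<in>gen j R. emeasure lebesgue Q) = emeasure lebesgue R" for j
    proof -
      define m where "m = measure lebesgue R / 2 ^ (j * CARD('a))"
      have "emeasure lebesgue Q = ennreal m" if "Q \<in> gen j R" for Q
        using measure_gen[OF that] cube_measure(1)[OF is_cube_gen(1)[OF that]] by (simp add: m_def)
      then have "(\<Sum>Q\<in>gen j R. emeasure lebesgue Q) = (\<Sum>Q\<in>gen j R. ennreal m)"
        by (intro sum.cong) auto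
      also have "\<dots> = ennreal (real (card (gen j R)) * m)"
        by (simp add: ennreal_mult m_def ennreal_of_nat_eq_real_of_nat del: times_divide_eq_right)
      also have "real (card (gen j R)) * m = measure lebesgue R"
        by (simp add: card_gen[OF cR] m_def)
      finally show ?thesis using cube_measure(1)[OF cR] by simp
    qed
    \<comment> \<open>The generations 0 to \<open>N - 1\<close> are \<open>N\<close> in number and
      give the total N|R|, already more than \<xi>|R|.\<close>
    let ?F = "\<Union>j\<in>{..<N}. gen j R"
    have "ennreal (real N * measure lebesgue R) = (\<Sum>j<N. emeasure lebesgue R)"
      using cube_measure(1)[OF cR] by (simp add: ennreal_mult'' ennreal_of_nat_eq_real_of_nat)
    also have "\<dots> = (\<Sum>Q\<in>?F. emeasure lebesgue Q)"
      by (subst sum.UNION_disjoint) (auto simp: level finite_gen[OF cR] gen_disjoint_levels)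
    also have "\<dots> = (\<Sum>\<^sub>\<infinity>Q\<in>?F. emeasure lebesgue Q)"
      by (subst infsum_finite) (auto simp: finite_gen[OF cR])
    also have "\<dots> \<le> (\<Sum>\<^sub>\<infinity>Q\<in>{Q \<in> \<S>. Q \<subseteq> R}. emeasure lebesgue Q)"
    proof (rule infsum_mono_neutral)
      \<comment> \<open>Vacuous: all cubes of \<open>?F\<close> are in \<open>\<S>\<close> and
        contained in \<open>R\<close>.\<close>
      show "emeasure lebesgue Q \<le> 0" if "Q \<in> ?F - {Q \<in> \<S>. Q \<subseteq> R}" for Q
        using that all[OF less_imp_le] gen_subset[of _ _ R] by blast
    qed (auto intro!: nonneg_summable_on_complete)
    also have "\<dots> \<le> ennreal (\<xi> * measure lebesgue R)"
      using xi(2)[OF R] xi(1) cube_measure(1)[OF cR] by (simp add: ennreal_mult)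
    finally have "real N * measure lebesgue R \<le> \<xi> * measure lebesgue R"
      using xi(1) by (subst (asm) ennreal_le_iff) auto
    then show False using N cube_measure(2)[OF cR] by simp
  qed
qed

section \<open>A criterion for porosity\<close>

text \<open>Since d is at least 1, there are at least two children; they are disjoint, so a single
  point cannot lie in both.\<close>

lemma free_child:
  fixes R :: "(real ^ 'd) set"
  assumes "is_cube R" "R \<inter> E \<subseteq> {x}"
  obtains M where "M \<in> gen 1 R" "M \<inter> E = {}"
proof -
  have "2 ^ 1 \<le> (2::nat) ^ CARD('d)" by (intro power_increasing) (auto simp: Suc_le_eq)
  then have "\<not> card (gen 1 R) \<le> 1" using card_gen[OF assms(1), of 1] by simp
  then obtain M M' where M: "M \<in> gen 1 R" "M' \<in> gen 1 R" "M \<noteq> M'"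
    using finite_gen[OF assms(1), of 1] by (metis card_le_Suc0_iff_eq One_nat_def)
  then have "M \<inter> M' = {}"
    using disjoint_gen[OF assms(1)] unfolding disjoint_def by blast
  then have "M \<inter> E = {} \<or> M' \<inter> E = {}"
    using gen_subset[OF M(1)] gen_subset[OF M(2)] assms(2) by blast
  then show thesis using M that by blast
qed

text \<open>Reduces the search for free cubes to that for descendants holding at most one point of
  \<open>E\<close>, as one further subdivision frees a child.\<close>

lemma porousI:
  fixes \<D> :: "(real ^ 'd) set set"
  assumes D: "dyadic_lattice \<D>" and "E \<noteq> {}"
    and sparse: "\<And>R. R \<in> \<D> \<Longrightarrow> \<exists>j\<le>N. \<exists>Q\<in>gen j R. \<exists>x. Q \<inter> E \<subseteq> {x}"
  shows "porous \<D> E"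
proof -
  \<comment> \<open>At most \<open>N\<close> generations lead from \<open>R\<close> to
    \<open>Q\<close>, and one more to the free child.\<close>
  define \<eta> :: real where "\<eta> = 2 ^ ((N + 1) * CARD('d))"
  have "\<exists>M. free_cube \<D> E M \<and> M \<subseteq> R \<and> \<eta> * measure lebesgue M \<ge> measure lebesgue R"
    if R: "R \<in> \<D>" for R
  proof -
    obtain j Q x where j: "j \<le> N" and Q: "Q \<in> gen j R" "Q \<inter> E \<subseteq> {x}"
      using sparse[OF R] by blast
    obtain M where M: "M \<in> gen 1 Q" "M \<inter> E = {}"
      using free_child[OF is_cube_gen(1)[OF Q(1)] Q(2)] by blast
    have MR: "M \<in> gen (j + 1) R" using gen_trans[OF Q(1) M(1)] .
    have "(j + 1) * CARD('d) \<le> (N + 1) * CARD('d)"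
      using j by (intro mult_right_mono) auto
    then have "(2::real) ^ ((j + 1) * CARD('d)) \<le> \<eta>"
      unfolding \<eta>_def by (intro power_increasing) auto
    then have "measure lebesgue R \<le> \<eta> * measure lebesgue M"
      unfolding measure_gen[OF MR] by (intro mult_right_mono) auto
    then show ?thesis
      using M(2) lattice_gen[OF D R MR] gen_subset[OF MR] by (auto simp: free_cube_def)
  qed
  moreover have "\<eta> > 1"
    unfolding \<eta>_def by (rule one_less_power) auto
  ultimately show ?thesis
    using assms(2) unfolding porous_def by blast
qed

section \<open>Construction of the porous set\<close>

theorem theorem3:
  fixes \<D> \<S> :: "(real ^ 'd) set set"
  assumes "dyadic_lattice \<D>"
    and "Carleson \<D> \<S>"
    and "\<forall>Q\<in>\<S>. parent \<D> Q \<in> \<S>"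
  shows "\<exists>E. porous \<D> E \<and> \<S> \<subseteq> cubes_meeting \<D> E"
proof (cases "\<S> = {}")
  \<comment> \<open>Here the set \<open>E\<close> of the other case would be empty, so a singleton
    is taken instead; every cube, being its own generation 0, meets it in at most one point.\<close>
  case True
  have "porous \<D> {0}"
  proof (rule porousI[OF assms(1), where N = 0])
    fix R assume "R \<in> \<D>"
    then have "gen 0 R = {R}" using gen_0 lattice_cube[OF assms(1)] by blast
    then show "\<exists>j\<le>0. \<exists>Q\<in>gen j R. \<exists>x. Q \<inter> {0} \<subseteq> {x}" by auto
  qed simp
  then show ?thesis using True by blast
next
  case False
  note D = assms(1) and closed = ancestor_closed[OF assms(1,3)]
  have SD: "\<S> \<subseteq> \<D>" using assms(2) by (simp add: Carleson_def)
  obtain N where N: "\<And>R. R \<in> \<D> \<Longrightarrow> \<exists>j\<le>N. \<exists>Q\<in>gen j R. Q \<notin> \<S>"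
    using Carleson_gap[OF assms(1,2)] by blast
  define B where "B = {P \<in> \<D>. P \<notin> \<S> \<and> parent \<D> P \<in> \<S>}"
  define c where "c P = (SOME x. x \<in> P)" for P :: "(real ^ 'd) set"
  define E where "E = c ` B"
  have c: "c P \<in> P" if "P \<in> \<D>" for P
    using cube_nonempty[OF lattice_cube[OF D that]] unfolding c_def by (simp add: some_in_eq)
  have meets: "Q \<inter> E \<noteq> {}" if Q: "Q \<in> \<S>" for Q
  proof -
    have QD: "Q \<in> \<D>" using Q SD by blast
    \<comment> \<open>At the first generation with a cube \<open>R\<close> outside
      \<open>\<S>\<close>, minimality puts the parent of \<open>R\<close> in \<open>\<S>\<close>, so
      \<open>R\<close> belongs to \<open>B\<close>.\<close>
    define j where "j = (LEAST j. \<exists>R\<in>gen j Q. R \<notin> \<S>)"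
    have "\<exists>j. \<exists>R\<in>gen j Q. R \<notin> \<S>" using N[OF QD] by blast
    then have "\<exists>R\<in>gen j Q. R \<notin> \<S>" unfolding j_def by (rule LeastI_ex)
    then obtain R where R: "R \<in> gen j Q" "R \<notin> \<S>" by blast
    have "j \<noteq> 0" using R Q gen_0[OF lattice_cube[OF D QD]] by (cases j) auto
    then obtain i where i: "j = Suc i" using not0_implies_Suc by blast
    have "R \<in> gen (i + 1) Q" using R(1) by (simp add: i)
    then obtain P where P: "P \<in> gen i Q" "R \<in> gen 1 P" by (rule gen_split)
    have "P \<in> \<S>" using P(1) not_less_Least[of i "\<lambda>j. \<exists>R\<in>gen j Q. R \<notin> \<S>"]
      unfolding j_def[symmetric] i by blast
    then have "R \<in> B"
      using parent_eq[OF D lattice_gen[OF D QD P(1)] P(2)] R lattice_gen[OF D QD R(1)]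
      by (simp add: B_def)
    then show ?thesis
      using c gen_subset[OF R(1)] unfolding E_def B_def by blast
  qed
  \<comment> \<open>Otherwise \<open>R\<close> would be a proper ancestor of \<open>P\<close>, hence
    an ancestor of (or equal to) the parent \<open>T\<close> of \<open>P\<close>. As
    \<open>T\<close> is in \<open>\<S>\<close>, upward closure would put \<open>R\<close> there
    too.\<close>
  have maximal: "R \<in> descendants P" if P: "P \<in> B" and R: "R \<in> \<D>" "R \<notin> \<S>" "P \<inter> R \<noteq> {}" for P R
  proof (rule ccontr)
    assume n: "R \<notin> descendants P"
    have PD: "P \<in> \<D>" using P by (simp add: B_def)
    obtain j where j: "P \<in> gen j R"
      using n lattice_nested[OF D PD R(1,3)] by (auto simp: descendants_def)
    show False
    proof (cases j)
      case 0
      then have "P = R" using j gen_0[OF lattice_cube[OF D R(1)]] by simp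
      then show False
        using n gen_0[OF lattice_cube[OF D PD]] by (auto simp: descendants_def)
    next
      case (Suc i)
      then have "P \<in> gen (i + 1) R" using j by simp
      then obtain T where T: "T \<in> gen i R" "P \<in> gen 1 T" by (rule gen_split)
      then have "T \<in> \<S>"
        using parent_eq[OF D lattice_gen[OF D R(1) T(1)] T(2)] P by (simp add: B_def)
      then show False using closed[OF R(1) T(1)] R(2) by blast
    qed
  qed
  have desc_sub: "R \<subseteq> P" if "R \<in> descendants P" for R P :: "(real ^ 'd) set"
    using that gen_subset by (auto simp: descendants_def)
  have one_point: "\<exists>x. R \<inter> E \<subseteq> {x}" if R: "R \<in> \<D>" "R \<notin> \<S>" for R
  proof -
    \<comment> \<open>Both cubes contain \<open>R\<close> by \<open>maximal\<close>, so they
      intersect; applying \<open>maximal\<close> to the pair in both orders yields mutual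
      inclusion.\<close>
    have "P = P'" if "P \<in> B" "P' \<in> B" "c P \<in> R" "c P' \<in> R" for P P'
    proof -
      have PD: "P \<in> \<D>" "P' \<in> \<D>" "P \<notin> \<S>" "P' \<notin> \<S>" using that by (auto simp: B_def)
      have "R \<subseteq> P" "R \<subseteq> P'"
        using maximal[OF _ R] that c PD desc_sub by blast+
      then have "P \<inter> P' \<noteq> {}" using that(3) by blast
      then show ?thesis
        using maximal[of P P'] maximal[of P' P] that(1,2) PD desc_sub by blast
    qed
    then show ?thesis unfolding E_def by blast
  qed
  have "porous \<D> E"
  proof (rule porousI[OF D, where N = N])
    show "E \<noteq> {}" using meets False by blast
    \<comment> \<open>The descendant outside \<open>\<S>\<close> supplied by the Carleson gap is the
      one with at most one point of \<open>E\<close>.\<close>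
    show "\<exists>j\<le>N. \<exists>Q\<in>gen j R. \<exists>x. Q \<inter> E \<subseteq> {x}" if "R \<in> \<D>" for R
      using N[OF that] one_point lattice_gen[OF D that] by blast
  qed
  then show ?thesis
    using meets SD unfolding cubes_meeting_def by blast
qed

end
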